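(* Let $X$ be a real Banach space and let $x\in S_X$. If $x$ is a relative Daugavet-point, then $x$ is a $\Delta$-point.
   Context: All Banach spaces are real. $B_X$ and $S_X$ denote the closed unit ball and unit sphere of $X$. A slice of $B_X$ is a set of the form $S(x^*,\alpha)=\{y\in B_X:\ x^*(y)>\sup x^*(B_X)-\alpha\}$ with $x^*\in X^*$ and $\alpha>0$. For $x\in S_X$ let $D(x)=\{x^*\in S_{X^*}:\ x^*(x)=1\}$; a supporting slice at $x$ is a slice $S(x^*,\alpha)$ with $x^*\in D(x)$ and $\alpha>0$. A point $x\in S_X$ is a Daugavet-point relative to a supporting slice $S$ at $x$ if $\sup_{y\in T}\|x-y\|=2$ for every slice $T$ of $B_X$ with $T\subseteq S$. A point $x\in S_X$ is a relative Daugavet-point if it is a Daugavet-point relative to some supporting slice at $x$. A point $x\in S_X$ is a $\Delta$-point if $\sup_{y\in T}\|x-y\|=2$ for every slice $T$ of $B_X$ containing $x$. *)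

theory Defs
  imports "HOL-Analysis.Analysis"
begin

text \<open>
  The dual space is the type of bounded linear functionals, normed by the operator norm.
  The functional \<open>f\<close> of a slice is arbitrary; for \<open>f = 0\<close> the slice is the whole unit ball.
\<close>

definition slice :: "('a::banach \<Rightarrow>\<^sub>L real) \<Rightarrow> real \<Rightarrow> 'a set" where
  "slice f \<alpha> =
     {y \<in> cball 0 1. blinfun_apply f y > (SUP z\<in>cball 0 1. blinfun_apply f z) - \<alpha>}"

definition is_slice :: "'a::banach set \<Rightarrow> bool" where
  "is_slice T \<longleftrightarrow> (\<exists>f \<alpha>. \<alpha> > 0 \<and> T = slice f \<alpha>)"

definition duality_set :: "'a::banach \<Rightarrow> ('a \<Rightarrow>\<^sub>L real) set" where
  "duality_set x = {f \<in> sphere 0 1. blinfun_apply f x = 1}"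

definition supporting_slice :: "'a::banach \<Rightarrow> 'a set \<Rightarrow> bool" where
  "supporting_slice x S \<longleftrightarrow> (\<exists>f \<alpha>. f \<in> duality_set x \<and> \<alpha> > 0 \<and> S = slice f \<alpha>)"

text \<open>
  The real-valued suprema below are genuine ones: a slice is bounded, and it is nonempty
  because its width is positive.
\<close>

definition Daugavet_point_relative_to :: "'a::banach \<Rightarrow> 'a set \<Rightarrow> bool" where
  "Daugavet_point_relative_to x S \<longleftrightarrow>
     x \<in> sphere 0 1 \<and> supporting_slice x S \<and>
     (\<forall>T. is_slice T \<and> T \<subseteq> S \<longrightarrow> (SUP y\<in>T. norm (x - y)) = 2)"

definition relative_Daugavet_point :: "'a::banach \<Rightarrow> bool" where
  "relative_Daugavet_point x \<longleftrightarrow>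
     x \<in> sphere 0 1 \<and> (\<exists>S. supporting_slice x S \<and> Daugavet_point_relative_to x S)"

definition Delta_point :: "'a::banach \<Rightarrow> bool" where
  "Delta_point x \<longleftrightarrow>
     x \<in> sphere 0 1 \<and>
     (\<forall>T. is_slice T \<and> x \<in> T \<longrightarrow> (SUP y\<in>T. norm (x - y)) = 2)"

end

theory Submission
  imports Defs
begin

text \<open>
  Let \<open>S\<close> be the slice of width \<open>\<alpha>\<close> of a functional \<open>f\<close> supporting the ball at \<open>x\<close>, and let
  \<open>T\<close> be any slice containing \<open>x\<close>, of width \<open>\<beta>\<close> and functional \<open>g\<close>.  It is enough to find a slice
  inside \<open>S \<inter> T\<close>: on it the distances to \<open>x\<close> already have supremum 2, and no point of the ball
  is farther than 2 from \<open>x\<close>.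

  Such a slice comes from \<open>h = g + t f\<close> with \<open>t > 0\<close>.  Let \<open>h y\<close> be within \<open>\<delta>\<close> of the
  supremum of \<open>h\<close>; then \<open>h y > h x - \<delta>\<close>.  Since \<open>f\<close> attains its maximum on the ball at \<open>x\<close>,
  moving from \<open>x\<close> to \<open>y\<close> gains nothing through \<open>f\<close>, so \<open>g y > g x - \<delta>\<close>, which puts \<open>y\<close> in
  \<open>T\<close> for small \<open>\<delta>\<close>.  Conversely the move gains at most \<open>sup g - g x < \<beta>\<close> through \<open>g\<close>, so
  \<open>t (f x - f y) < sup g - g x + \<delta>\<close>, which puts \<open>y\<close> in \<open>S\<close> for large \<open>t\<close>.  The new slice may
  miss \<open>x\<close>; this is why the argument uses the hypothesis for slices inside \<open>S\<close> whether or not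
  they contain \<open>x\<close>.
\<close>

lemma bdd_above_blinfun_unit_ball:
  fixes f :: "'a::banach \<Rightarrow>\<^sub>L real"
  shows "bdd_above (blinfun_apply f ` cball 0 1)"
  by (intro bounded_imp_bdd_above bounded_linear_image[OF bounded_cball blinfun.bounded_linear_right])

lemma blinfun_le_SUP_unit_ball:
  fixes f :: "'a::banach \<Rightarrow>\<^sub>L real"
  assumes "y \<in> cball 0 1"
  shows "blinfun_apply f y \<le> (SUP z\<in>cball 0 1. blinfun_apply f z)"
  using assms by (intro cSUP_upper bdd_above_blinfun_unit_ball)

lemma duality_set_SUP:
  assumes "f \<in> duality_set x" and "x \<in> sphere 0 1"
  shows "(SUP z\<in>cball 0 1. blinfun_apply f z) = 1"
proof (rule antisym)
  have "blinfun_apply f z \<le> 1" if "z \<in> cball 0 1" for z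
  proof -
    have "norm (blinfun_apply f z) \<le> norm f * norm z" by (rule norm_blinfun)
    with that assms(1) show ?thesis by (simp add: duality_set_def)
  qed
  then show "(SUP z\<in>cball 0 1. blinfun_apply f z) \<le> 1"
    by (intro cSUP_least) auto
  show "1 \<le> (SUP z\<in>cball 0 1. blinfun_apply f z)"
    using blinfun_le_SUP_unit_ball[of x f] assms by (simp add: duality_set_def)
qed

lemma slice_nonempty:
  assumes "\<alpha> > 0"
  shows "slice f \<alpha> \<noteq> {}"
proof -
  have "\<exists>y\<in>cball 0 1. (SUP z\<in>cball 0 1. blinfun_apply f z) - \<alpha> < blinfun_apply f y"
    using assms bdd_above_blinfun_unit_ball[of f]
    by (subst less_cSUP_iff[symmetric]) auto
  then show ?thesis by (auto simp: slice_def)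
qed

text \<open>
  Adding a large multiple of the supporting functional \<open>f\<close> to \<open>g\<close> forces near-maximality for
  both: \<open>x\<close> maximises \<open>f\<close> and comes within the width of \<open>T\<close> of maximising \<open>g\<close>, so neither
  functional can make up for a large loss in the other.
\<close>

lemma supporting_slice_Int_slice_contains_slice:
  assumes x: "x \<in> sphere 0 1" and S: "supporting_slice x S"
    and T: "is_slice T" and xT: "x \<in> T"
  obtains U where "is_slice U" and "U \<subseteq> S" and "U \<subseteq> T"
proof -
  obtain f \<alpha> where f: "f \<in> duality_set x" and \<alpha>: "\<alpha> > 0" and S_eq: "S = slice f \<alpha>"
    using S by (auto simp: supporting_slice_def)
  obtain g \<beta> where \<beta>: "\<beta> > 0" and T_eq: "T = slice g \<beta>"
    using T by (auto simp: is_slice_def)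
  define sup_g where "sup_g = (SUP z\<in>cball 0 1. blinfun_apply g z)"
  \<comment> \<open>The width is the margin by which \<open>x\<close> lies in \<open>T\<close>.  Together with the possible gain
    \<open>sup_g - g x\<close> through \<open>g\<close> it makes up exactly \<open>\<beta>\<close>, so \<open>t = \<beta> / \<alpha>\<close> is large enough.\<close>
  define \<delta> where "\<delta> = \<beta> - (sup_g - blinfun_apply g x)"
  define t where "t = \<beta> / \<alpha>"
  define h where "h = g + t *\<^sub>R f"
  have \<delta>: "\<delta> > 0" using xT by (simp add: T_eq slice_def \<delta>_def sup_g_def)
  have t: "t > 0" and t\<alpha>: "t * \<alpha> = \<beta>" using \<alpha> \<beta> by (auto simp: t_def)
  have h_apply: "blinfun_apply h z = blinfun_apply g z + t * blinfun_apply f z" for z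
    by (simp add: h_def blinfun.add_left blinfun.scaleR_left)
  have fx: "blinfun_apply f x = 1" using f by (simp add: duality_set_def)
  have sup_h: "blinfun_apply g x + t \<le> (SUP z\<in>cball 0 1. blinfun_apply h z)"
    using blinfun_le_SUP_unit_ball[of x h] x by (simp add: h_apply fx)
  have "y \<in> S \<and> y \<in> T" if "y \<in> slice h \<delta>" for y
  proof -
    have y: "y \<in> cball 0 1"
      and hy: "blinfun_apply h y > (SUP z\<in>cball 0 1. blinfun_apply h z) - \<delta>"
      using that by (auto simp: slice_def)
    have near: "blinfun_apply g y + t * blinfun_apply f y > blinfun_apply g x + t - \<delta>"
      using hy sup_h by (simp add: h_apply)
    have fy: "blinfun_apply f y \<le> 1"
      using blinfun_le_SUP_unit_ball[OF y, of f] duality_set_SUP[OF f x] by simp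
    have gy: "blinfun_apply g y \<le> sup_g"
      using blinfun_le_SUP_unit_ball[OF y, of g] by (simp add: sup_g_def)
    have "t * blinfun_apply f y \<le> t" using fy t by simp
    with near have "blinfun_apply g y > sup_g - \<beta>" by (simp add: \<delta>_def)
    moreover have "t * blinfun_apply f y > t * (1 - \<alpha>)"
      using near gy t\<alpha> by (simp add: \<delta>_def right_diff_distrib)
    then have "blinfun_apply f y > 1 - \<alpha>" using t by simp
    ultimately show ?thesis
      using y duality_set_SUP[OF f x] by (simp add: S_eq T_eq slice_def sup_g_def)
  qed
  then have "slice h \<delta> \<subseteq> S" and "slice h \<delta> \<subseteq> T" by auto
  moreover have "is_slice (slice h \<delta>)" using \<delta> by (auto simp: is_slice_def)
  ultimately show ?thesis using that by blast
qed

theorem lemma3p4: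
  fixes x :: "'a::banach"
  assumes "x \<in> sphere 0 1"
    and "relative_Daugavet_point x"
  shows "Delta_point x"
proof -
  obtain S where S: "supporting_slice x S"
    and rel: "\<And>U. is_slice U \<Longrightarrow> U \<subseteq> S \<Longrightarrow> (SUP y\<in>U. norm (x - y)) = 2"
    using assms(2) by (auto simp: relative_Daugavet_point_def Daugavet_point_relative_to_def)
  have "(SUP y\<in>T. norm (x - y)) = 2" if T: "is_slice T" and xT: "x \<in> T" for T
  proof (rule antisym)
    have le2: "norm (x - y) \<le> 2" if "y \<in> T" for y
    proof -
      have "norm y \<le> 1" using T that by (auto simp: is_slice_def slice_def)
      with assms(1) show ?thesis using norm_triangle_ineq4[of x y] by simp
    qed
    then show "(SUP y\<in>T. norm (x - y)) \<le> 2"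
      using xT by (intro cSUP_least) auto
    obtain U where U: "is_slice U" "U \<subseteq> S" "U \<subseteq> T"
      using supporting_slice_Int_slice_contains_slice[OF assms(1) S T xT] .
    have "U \<noteq> {}" using U(1) slice_nonempty by (auto simp: is_slice_def)
    moreover have "bdd_above ((\<lambda>y. norm (x - y)) ` T)" using le2 by (rule bdd_aboveI2)
    ultimately have "(SUP y\<in>U. norm (x - y)) \<le> (SUP y\<in>T. norm (x - y))"
      using U(3) by (intro cSUP_subset_mono) auto
    then show "2 \<le> (SUP y\<in>T. norm (x - y))" using rel[OF U(1,2)] by simp
  qed
  then show ?thesis using assms(1) by (simp add: Delta_point_def)
qed

end
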